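(* Let $n$ be a positive integer. There does not exist a closed subset $\Sigma\subset(\mathbb{R}^{n+1})^{2n+1}$ with Lebesgue measure zero such that for any point $p=(p_0,p_1,\ldots,p_{2n})\in(\mathbb{R}^{n+1})^{2n+1}-\Sigma$ the following two hold: (1) For every real $(2n+1)\times(n+1)$ matrix $A$ with non-zero entries such that the rank of $A$ is $n+1$, the mapping $G_{(p,A)}:\mathbb{R}^{n+1}\to\mathbb{R}^{2n+1}$ is $\mathcal{A}$-equivalent to the mapping $\mathbb{R}^{n+1}\to\mathbb{R}^{2n+1}$ \[ (x_0,x_1,\ldots,x_n)\mapsto(x_0^2,\,x_0x_1,\ldots,x_0x_n,\,x_1,\ldots,x_n). \] (2) For every real $(2n+1)\times(n+1)$ matrix $A$ with non-zero entries such that the rank of $A$ is less than $n+1$, the mapping $G_{(p,A)}$ is $\mathcal{A}$-equivalent to the inclusion $\mathbb{R}^{n+1}\to\mathbb{R}^{2n+1}$, $(x_0,x_1,\ldots,x_n)\mapsto(x_0,x_1,\ldots,x_n,0,\ldots,0)$.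
   Context: For positive integers $k,n$, points $p_i=(p_{i0},p_{i1},\ldots,p_{in})\in\mathbb{R}^{n+1}$ $(0\le i\le k)$, and a real $(k+1)\times(n+1)$ matrix $A=(a_{ij})_{0\le i\le k,\,0\le j\le n}$ with all entries non-zero, write $p=(p_0,\ldots,p_k)\in(\mathbb{R}^{n+1})^{k+1}$. The generalized distance-squared mapping $G_{(p,A)}=G_{(p_0,p_1,\ldots,p_k,A)}:\mathbb{R}^{n+1}\to\mathbb{R}^{k+1}$ is defined by \[ G_{(p,A)}(x)=\left(\sum_{j=0}^n a_{0j}(x_j-p_{0j})^2,\ \sum_{j=0}^n a_{1j}(x_j-p_{1j})^2,\ \ldots,\ \sum_{j=0}^n a_{kj}(x_j-p_{kj})^2\right),\quad x=(x_0,\ldots,x_n)\in\mathbb{R}^{n+1}. \] Here $k=2n$. Two mappings $f_1,f_2:\mathbb{R}^{n+1}\to\mathbb{R}^{k+1}$ are $\mathcal{A}$-equivalent if there exist $C^\infty$ diffeomorphisms $h:\mathbb{R}^{n+1}\to\mathbb{R}^{n+1}$ and $H:\mathbb{R}^{k+1}\to\mathbb{R}^{k+1}$ such that $f_1=H\circ f_2\circ h$. *)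

theory Defs
  imports "HOL-Analysis.Analysis"
begin

text \<open>
  Indices: for a finite type \<open>'n\<close> with \<open>n = CARD('n)\<close> (so \<open>n \<ge> 1\<close>), the coordinates
  \<open>0, 1, \<dots>, n\<close> are the elements of \<open>'n option\<close> (\<open>None\<close> is \<open>0\<close>), and the coordinates
  \<open>0, 1, \<dots>, 2n\<close> are the elements of \<open>('n + 'n) option\<close>: first \<open>None\<close>, then the \<open>n\<close>
  elements \<open>Some (Inl i)\<close>, then the \<open>n\<close> elements \<open>Some (Inr i)\<close>.
\<close>

text \<open>In finite dimension, continuity of all iterated directional derivatives of order at
  most \<open>r\<close> is the usual \<open>C^r\<close> condition.\<close>

primrec Cr_map :: "nat \<Rightarrow> ('a::euclidean_space \<Rightarrow> 'b::euclidean_space) \<Rightarrow> bool" where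
  "Cr_map 0 f \<longleftrightarrow> continuous_on UNIV f"
| "Cr_map (Suc r) f \<longleftrightarrow>
     (\<forall>x. f differentiable (at x)) \<and> (\<forall>v. Cr_map r (\<lambda>x. frechet_derivative f (at x) v))"

definition smooth_map :: "('a::euclidean_space \<Rightarrow> 'b::euclidean_space) \<Rightarrow> bool" where
  "smooth_map f \<longleftrightarrow> (\<forall>r. Cr_map r f)"

definition smooth_diffeo :: "('a::euclidean_space \<Rightarrow> 'b::euclidean_space) \<Rightarrow> bool" where
  "smooth_diffeo f \<longleftrightarrow> bij f \<and> smooth_map f \<and> smooth_map (inv f)"

definition A_equivalent ::
  "('a::euclidean_space \<Rightarrow> 'b::euclidean_space) \<Rightarrow> ('a \<Rightarrow> 'b) \<Rightarrow> bool" where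
  "A_equivalent f1 f2 \<longleftrightarrow>
     (\<exists>(h :: 'a \<Rightarrow> 'a) (H :: 'b \<Rightarrow> 'b).
        smooth_diffeo h \<and> smooth_diffeo H \<and> f1 = H \<circ> f2 \<circ> h)"

definition gen_dist_sq :: "(real ^ 'm) ^ 'k \<Rightarrow> (real ^ 'm) ^ 'k \<Rightarrow> real ^ 'm \<Rightarrow> real ^ 'k" where
  "gen_dist_sq p A x = (\<chi> i. \<Sum>j\<in>UNIV. A $ i $ j * (x $ j - p $ i $ j)\<^sup>2)"

definition nonzero_entries :: "(real ^ 'm) ^ 'k \<Rightarrow> bool" where
  "nonzero_entries A \<longleftrightarrow> (\<forall>i j. A $ i $ j \<noteq> 0)"

text \<open>\<open>(x\<^sub>0, \<dots>, x\<^sub>n) \<mapsto> (x\<^sub>0\<^sup>2, x\<^sub>0 x\<^sub>1, \<dots>, x\<^sub>0 x\<^sub>n, x\<^sub>1, \<dots>, x\<^sub>n)\<close>\<close>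

definition whitney_umbrella :: "real ^ ('n option) \<Rightarrow> real ^ (('n::finite + 'n) option)" where
  "whitney_umbrella x =
     (\<chi> i. case i of
        None \<Rightarrow> (x $ None)\<^sup>2
      | Some (Inl j) \<Rightarrow> x $ None * x $ Some j
      | Some (Inr j) \<Rightarrow> x $ Some j)"

text \<open>\<open>(x\<^sub>0, \<dots>, x\<^sub>n) \<mapsto> (x\<^sub>0, x\<^sub>1, \<dots>, x\<^sub>n, 0, \<dots>, 0)\<close>\<close>

definition std_inclusion :: "real ^ ('n option) \<Rightarrow> real ^ (('n::finite + 'n) option)" where
  "std_inclusion x =
     (\<chi> i. case i of
        None \<Rightarrow> x $ None
      | Some (Inl j) \<Rightarrow> x $ Some j
      | Some (Inr j) \<Rightarrow> 0)"

end

theory Submission imports Defs begin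

text \<open>
  For \<open>p\<close> in a suitable non-empty open set there is a matrix \<open>A\<close>, depending on \<open>p\<close>, of rank
  \<open>n + 1\<close> with non-zero entries and with \<open>\<Sum>\<^sub>i a\<^sub>i\<^sub>j = \<Sum>\<^sub>i a\<^sub>i\<^sub>j p\<^sub>i\<^sub>j = 0\<close> for every \<open>j\<close>. Then the sum of the
  components of \<open>G\<close> is constant, so the image of \<open>G\<close> lies in an affine hyperplane. The image of
  the umbrella, in contrast, lies in no level set of a \<open>C\<^sup>1\<close> submersion near the origin: the
  limits of its tangent spaces at points tending to \<open>0\<close> together span the
  target space. As a closed null set contains no non-empty open set, condition (1) fails.
\<close>

section \<open>The image of the umbrella is not contained in a smooth hypersurface\<close>

lemma has_derivative_comp_curve:
  fixes H :: "'a::real_normed_vector \<Rightarrow> 'b::real_inner" and \<gamma> :: "real \<Rightarrow> 'a"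
  assumes H: "(H has_derivative H') (at (\<gamma> s))" and g: "(\<gamma> has_vector_derivative v) (at s)"
    and const: "\<And>t. u \<bullet> H (\<gamma> t) = c"
  shows "u \<bullet> H' v = 0"
proof -
  have "((\<lambda>t. H (\<gamma> t)) has_derivative (\<lambda>t. H' (t *\<^sub>R v))) (at s)"
    using has_derivative_compose[OF g[unfolded has_vector_derivative_def] H] by simp
  then have "((\<lambda>t. u \<bullet> H (\<gamma> t)) has_derivative (\<lambda>t. u \<bullet> H' (t *\<^sub>R v))) (at s)"
    by (rule has_derivative_inner_right)
  moreover have "((\<lambda>t. u \<bullet> H (\<gamma> t)) has_derivative (\<lambda>t. 0)) (at s)"
    unfolding const by simp
  ultimately have "(\<lambda>t. u \<bullet> H' (t *\<^sub>R v)) = (\<lambda>t. 0)"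
    by (rule has_derivative_unique)
  from fun_cong[OF this, of 1] show ?thesis by simp
qed

lemma eq_0_if_isCont_punctured:
  fixes F :: "real \<Rightarrow> real"
  assumes "isCont F 0" and "\<And>t. t \<noteq> 0 \<Longrightarrow> F t = 0"
  shows "F 0 = 0"
proof -
  have "(F \<longlongrightarrow> 0) (at 0)"
    using assms(2) by (intro tendsto_eventually) (simp add: eventually_at_filter)
  then show ?thesis
    using assms(1) LIM_unique unfolding isCont_def by blast
qed

text \<open>The argument of \<open>H\<close> is the umbrella on a coordinate plane,
  \<open>(s, t)\<close> being sent to \<open>(s^2, s * t, t)\<close>. Tangent vectors of this
  surface are killed by the differential of \<open>u \<bullet> H\<close>. The directions
  \<open>a\<close> and \<open>b\<close> are tangent only at nearby points, so they are carried to
  the origin by continuity of the derivative; hence \<open>Cr_map 1\<close>.\<close>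

lemma inner_derivative_umbrella_slice_eq_0:
  fixes H :: "'a::euclidean_space \<Rightarrow> 'b::euclidean_space" and a b c :: 'a
  assumes H: "Cr_map 1 H"
    and const: "\<And>s t. u \<bullet> H (s\<^sup>2 *\<^sub>R a + (s * t) *\<^sub>R b + t *\<^sub>R c) = k"
  shows "u \<bullet> frechet_derivative H (at 0) a = 0"
    and "u \<bullet> frechet_derivative H (at 0) b = 0"
    and "u \<bullet> frechet_derivative H (at 0) c = 0"
proof -
  let ?D = "\<lambda>x. frechet_derivative H (at x)"
  have der: "(H has_derivative ?D x) (at x)" for x
    using H by (simp add: frechet_derivative_works)
  have lin: "linear (?D x)" for x
    using der has_derivative_linear by blast
  have cont: "isCont (\<lambda>x. ?D x v) x" for x v
    using H by (simp add: continuous_on_eq_continuous_at)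
  have contD: "isCont (\<lambda>t. u \<bullet> ?D (\<gamma> t) v) 0" if "isCont \<gamma> 0" for \<gamma> :: "real \<Rightarrow> 'a" and v
    by (intro continuous_intros isCont_o2[OF that cont])
  \<comment> \<open>Along \<open>t = 0\<close> the velocity \<open>2 * s *\<^sub>R a\<close>
    vanishes at the origin, so the factor is cancelled for \<open>s \<noteq> 0\<close> before
    passing to the limit.\<close>
  have "u \<bullet> ?D (0\<^sup>2 *\<^sub>R a) a = 0"
  proof (rule eq_0_if_isCont_punctured[where F = "\<lambda>s. u \<bullet> ?D (s\<^sup>2 *\<^sub>R a) a"])
    fix s :: real assume "s \<noteq> 0"
    have "((\<lambda>s. s\<^sup>2 *\<^sub>R a) has_vector_derivative (2 * s) *\<^sub>R a) (at s)"
      by (auto intro!: derivative_eq_intros)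
    then have "u \<bullet> ?D (s\<^sup>2 *\<^sub>R a) ((2 * s) *\<^sub>R a) = 0"
      using has_derivative_comp_curve[where \<gamma> = "\<lambda>s. s\<^sup>2 *\<^sub>R a" and s = s, OF der]
        const[of _ 0] by simp
    then show "u \<bullet> ?D (s\<^sup>2 *\<^sub>R a) a = 0"
      using \<open>s \<noteq> 0\<close> by (simp add: linear_cmul[OF lin])
  qed (intro contD continuous_intros)
  then show "u \<bullet> ?D 0 a = 0" by simp
  \<comment> \<open>For fixed \<open>t \<noteq> 0\<close> the curve in \<open>s\<close> passes
    through \<open>t *\<^sub>R c\<close> with velocity \<open>t *\<^sub>R b\<close>; again cancel,
    then let \<open>t\<close> tend to 0.\<close>
  have "u \<bullet> ?D (0 *\<^sub>R c) b = 0"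
  proof (rule eq_0_if_isCont_punctured[where F = "\<lambda>t. u \<bullet> ?D (t *\<^sub>R c) b"])
    fix t :: real assume "t \<noteq> 0"
    let ?\<gamma> = "\<lambda>s. s\<^sup>2 *\<^sub>R a + (s * t) *\<^sub>R b + t *\<^sub>R c"
    have "(?\<gamma> has_vector_derivative t *\<^sub>R b) (at 0)"
      by (auto intro!: derivative_eq_intros)
    then have "u \<bullet> ?D (?\<gamma> 0) (t *\<^sub>R b) = 0"
      by (rule has_derivative_comp_curve[where \<gamma> = ?\<gamma> and s = 0, OF der]) (rule const)
    then show "u \<bullet> ?D (t *\<^sub>R c) b = 0"
      using \<open>t \<noteq> 0\<close> by (simp add: linear_cmul[OF lin])
  qed (intro contD continuous_intros)
  then show "u \<bullet> ?D 0 b = 0" by simp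
  have "((\<lambda>t. t *\<^sub>R c) has_vector_derivative c) (at 0)"
    by (auto intro!: derivative_eq_intros)
  then have "u \<bullet> ?D (0 *\<^sub>R c) c = 0"
    using has_derivative_comp_curve[where \<gamma> = "\<lambda>t. t *\<^sub>R c" and s = 0, OF der]
      const[of 0] by simp
  then show "u \<bullet> ?D 0 c = 0" by simp
qed

text \<open>Differentiating \<open>H (inv H y) = y\<close> at \<open>H x\<close> gives a right
  inverse of the derivative.\<close>

lemma surj_frechet_derivative_smooth_diffeo:
  assumes "smooth_diffeo H"
  shows "surj (frechet_derivative H (at x))"
proof -
  have bij: "bij H" and sm: "smooth_map H" "smooth_map (inv H)"
    using assms by (auto simp: smooth_diffeo_def)
  have "Cr_map (Suc 0) H" "Cr_map (Suc 0) (inv H)"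
    using sm unfolding smooth_map_def by blast+
  then have "H differentiable at x" "inv H differentiable at (H x)"
    unfolding Cr_map.simps by blast+
  then have d: "(H has_derivative frechet_derivative H (at x)) (at x)"
    "(inv H has_derivative frechet_derivative (inv H) (at (H x))) (at (H x))"
    unfolding frechet_derivative_works .
  have inv: "inv H (H x) = x" "\<And>y. H (inv H y) = y"
    using bij by (simp_all add: bij_is_inj bij_is_surj surj_f_inv_f)
  have "((\<lambda>y. H (inv H y)) has_derivative
      (\<lambda>v. frechet_derivative H (at x) (frechet_derivative (inv H) (at (H x)) v))) (at (H x))"
    by (rule has_derivative_compose[OF d(2)]) (simp only: inv d(1))
  then have "(\<lambda>v. frechet_derivative H (at x) (frechet_derivative (inv H) (at (H x)) v)) = (\<lambda>v. v)"
    unfolding inv by (rule has_derivative_unique) (rule has_derivative_ident)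
  then have "frechet_derivative H (at x) (frechet_derivative (inv H) (at (H x)) v) = v" for v
    by (rule fun_cong)
  then show ?thesis by (rule surjI)
qed

lemma whitney_umbrella_slice:
  fixes j :: "'n::finite"
  shows "whitney_umbrella (s *\<^sub>R axis None 1 + t *\<^sub>R axis (Some j) 1) =
    s\<^sup>2 *\<^sub>R axis None 1 + (s * t) *\<^sub>R axis (Some (Inl j)) 1 + t *\<^sub>R axis (Some (Inr j)) 1"
proof (rule vec_eq_iff[THEN iffD2], rule allI)
  fix i :: "('n + 'n) option"
  consider "i = None" | k where "i = Some (Inl k)" | k where "i = Some (Inr k)"
    by (metis option.exhaust sum.exhaust)
  then show "whitney_umbrella (s *\<^sub>R axis None 1 + t *\<^sub>R axis (Some j) 1) $ i =
      (s\<^sup>2 *\<^sub>R axis None 1 + (s * t) *\<^sub>R axis (Some (Inl j)) 1 + t *\<^sub>R axis (Some (Inr j)) 1) $ i"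
    by cases (simp_all add: whitney_umbrella_def axis_def)
qed

text \<open>As \<open>j\<close> varies, the slices yield every axis of the target, so
  \<open>u\<close> is orthogonal to the whole range of the derivative of \<open>H\<close> at 0. That
  range contains \<open>u\<close> itself.\<close>

lemma A_equivalent_whitney_umbrella_not_in_hyperplane:
  fixes f :: "real ^ ('n::finite option) \<Rightarrow> real ^ (('n + 'n) option)"
  assumes "A_equivalent f whitney_umbrella" and "\<And>x. u \<bullet> f x = c"
  shows "u = 0"
proof -
  obtain h :: "real ^ ('n option) \<Rightarrow> real ^ ('n option)"
    and H :: "real ^ (('n + 'n) option) \<Rightarrow> real ^ (('n + 'n) option)"
    where h: "smooth_diffeo h" and H: "smooth_diffeo H"
    and f: "f = H \<circ> whitney_umbrella \<circ> h"
    using assms(1) unfolding A_equivalent_def by blast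
  \<comment> \<open>Surjectivity of \<open>h\<close> removes it from the problem.\<close>
  have "u \<bullet> H (whitney_umbrella z) = c" for z
  proof -
    obtain x where "z = h x"
      using h unfolding smooth_diffeo_def by (blast elim: bij_pointE)
    then show ?thesis using assms(2)[of x] f by simp
  qed
  then have const: "u \<bullet> H (s\<^sup>2 *\<^sub>R axis None 1 + (s * t) *\<^sub>R axis (Some (Inl j)) 1
      + t *\<^sub>R axis (Some (Inr j)) 1) = c" for s t and j :: 'n
    by (metis whitney_umbrella_slice)
  have C1: "Cr_map 1 H"
    using H unfolding smooth_diffeo_def smooth_map_def by blast
  let ?D = "frechet_derivative H (at 0)"
  have lin: "linear (\<lambda>v. u \<bullet> ?D v)"
    using C1 by (intro linear_compose[unfolded o_def, OF _ bounded_linear.linear[OF bounded_linear_inner_right]])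
      (auto simp: frechet_derivative_works dest: has_derivative_linear)
  have "u \<bullet> ?D (axis i 1) = 0" for i
  proof -
    consider "i = None" | k where "i = Some (Inl k)" | k where "i = Some (Inr k)"
      by (metis option.exhaust sum.exhaust)
    then show ?thesis
      by cases (simp_all add: inner_derivative_umbrella_slice_eq_0[OF C1 const])
  qed
  then have "u \<bullet> ?D b = 0" if "b \<in> Basis" for b
    using that by (auto simp: Basis_vec_def)
  then have "u \<bullet> ?D v = 0" for v
    by (rule linear_eq_0_on_span[OF lin, of Basis]) simp_all
  then have "u \<bullet> u = 0"
    using surj_frechet_derivative_smooth_diffeo[OF H, of 0] by (metis surjD)
  then show ?thesis by simp
qed

section \<open>Matrices that force the image into a hyperplane\<close>

text \<open>Expanding the squares, the coefficients of \<open>(x $ j)^2\<close> and of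
  \<open>x $ j\<close> in the total are multiples of the two sums assumed to vanish.\<close>

lemma sum_gen_dist_sq_const:
  fixes p A :: "(real ^ 'm::finite) ^ 'k::finite"
  assumes "\<And>j. (\<Sum>i\<in>UNIV. A $ i $ j) = 0" and "\<And>j. (\<Sum>i\<in>UNIV. A $ i $ j * p $ i $ j) = 0"
  shows "(\<Sum>i\<in>UNIV. gen_dist_sq p A x $ i) = (\<Sum>j\<in>UNIV. \<Sum>i\<in>UNIV. A $ i $ j * (p $ i $ j)\<^sup>2)"
proof -
  have "(\<Sum>i\<in>UNIV. A $ i $ j * (x $ j - p $ i $ j)\<^sup>2) = (\<Sum>i\<in>UNIV. A $ i $ j * (p $ i $ j)\<^sup>2)" for j
  proof -
    have "(\<Sum>i\<in>UNIV. A $ i $ j * (x $ j - p $ i $ j)\<^sup>2) =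
        (\<Sum>i\<in>UNIV. (x $ j)\<^sup>2 * A $ i $ j - 2 * x $ j * (A $ i $ j * p $ i $ j)
          + A $ i $ j * (p $ i $ j)\<^sup>2)"
      by (intro sum.cong) (auto simp: power2_eq_square algebra_simps)
    also have "\<dots> = (\<Sum>i\<in>UNIV. A $ i $ j * (p $ i $ j)\<^sup>2)"
      by (simp add: sum.distrib sum_subtractf assms flip: sum_distrib_left)
    finally show ?thesis .
  qed
  then show ?thesis
    by (simp add: gen_dist_sq_def) (subst sum.swap, simp)
qed

text \<open>Full column rank means having a left inverse. For a left inverse \<open>B\<close> of
  \<open>A0\<close>, the square matrix \<open>B ** A x\<close> has determinant tending to 1; once it
  is invertible, so is \<open>A x\<close> from the left.\<close>

lemma eventually_rank_full:
  fixes A :: "'a \<Rightarrow> (real ^ 'm::finite) ^ 'k::finite"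
  assumes "(A \<longlongrightarrow> A0) F" and "rank A0 = CARD('m)"
  shows "\<forall>\<^sub>F x in F. rank (A x) = CARD('m)"
proof -
  obtain B where B: "B ** A0 = mat 1"
    using assms(2) by (metis full_rank_injective matrix_left_invertible_injective)
  have "((\<lambda>x. det (B ** A x)) \<longlongrightarrow> det (B ** A0)) F"
    unfolding det_def matrix_matrix_mult_def
    by (simp, intro tendsto_intros assms(1))
  moreover have "det (B ** A0) \<noteq> 0"
    by (simp add: B)
  ultimately have "\<forall>\<^sub>F x in F. det (B ** A x) \<noteq> 0"
    by (rule tendsto_imp_eventually_ne)
  then show ?thesis
  proof eventually_elim
    case (elim x)
    then obtain C where "C ** (B ** A x) = mat 1"
      using invertible_det_nz invertible_def by blast
    then show ?case
      by (metis full_rank_injective matrix_left_invertible_injective matrix_mul_assoc)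
  qed
qed

text \<open>The column of \<open>A0\<close> is corrected by a multiple of the column of \<open>w\<close>; the correction vanishes
  at \<open>p = w\<close>.\<close>

lemma eventually_orthogonal_matrix:
  fixes A0 w :: "(real ^ 'm::finite) ^ 'k::finite"
  assumes nz: "nonzero_entries A0" and rk: "rank A0 = CARD('m)"
    and A0: "\<And>j. (\<Sum>i\<in>UNIV. A0 $ i $ j) = 0"
    and w: "\<And>j. (\<Sum>i\<in>UNIV. w $ i $ j) = 0"
    and orth: "\<And>j. (\<Sum>i\<in>UNIV. A0 $ i $ j * w $ i $ j) = 0"
    and w_nz: "\<And>j. (\<Sum>i\<in>UNIV. w $ i $ j * w $ i $ j) \<noteq> 0"
  shows "\<forall>\<^sub>F p in nhds w. \<exists>A :: (real ^ 'm) ^ 'k. nonzero_entries A \<and> rank A = CARD('m) \<and>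
    (\<forall>j. (\<Sum>i\<in>UNIV. A $ i $ j) = 0) \<and> (\<forall>j. (\<Sum>i\<in>UNIV. A $ i $ j * p $ i $ j) = 0)"
proof -
  define d where "d = (\<lambda>(p::(real ^ 'm) ^ 'k) j. \<Sum>i\<in>UNIV. w $ i $ j * p $ i $ j)"
  \<comment> \<open>\<open>c p j\<close> solves the linear equation making column \<open>j\<close>
    of \<open>A p\<close> orthogonal to that of \<open>p\<close>. By \<open>orth\<close> it is 0 at
    \<open>p = w\<close>. Column sums stay 0 because those of \<open>w\<close> are 0.\<close>
  define c where "c = (\<lambda>(p::(real ^ 'm) ^ 'k) j. (\<Sum>i\<in>UNIV. A0 $ i $ j * p $ i $ j) / d p j)"
  define A :: "(real ^ 'm) ^ 'k \<Rightarrow> (real ^ 'm) ^ 'k"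
    where "A = (\<lambda>p. \<chi> i j. A0 $ i $ j - c p j * w $ i $ j)"
  have id: "((\<lambda>p. p) \<longlongrightarrow> w) (nhds w)" by (rule filterlim_ident)
  have d_lim: "((\<lambda>p. d p j) \<longlongrightarrow> d w j) (nhds w)" for j
    unfolding d_def by (intro tendsto_intros id)
  have c_lim: "((\<lambda>p. c p j) \<longlongrightarrow> c w j) (nhds w)" for j
    unfolding c_def using w_nz by (intro tendsto_intros id d_lim) (simp add: d_def)
  have "(A \<longlongrightarrow> A w) (nhds w)"
    unfolding A_def by (intro tendsto_vec_lambda tendsto_intros c_lim)
  moreover have "A w = A0"
    by (simp add: A_def c_def orth vec_eq_iff)
  ultimately have A_lim: "(A \<longlongrightarrow> A0) (nhds w)" by simp
  have "\<forall>\<^sub>F p in nhds w. A p $ i $ j \<noteq> 0" for i j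
    using nz by (intro tendsto_imp_eventually_ne[OF tendsto_vec_nth[OF tendsto_vec_nth[OF A_lim]]])
      (simp add: nonzero_entries_def)
  then have "\<forall>\<^sub>F p in nhds w. \<forall>i j. A p $ i $ j \<noteq> 0"
    by (simp add: eventually_all_finite)
  moreover have "\<forall>\<^sub>F p in nhds w. d p j \<noteq> 0" for j
    using w_nz by (intro tendsto_imp_eventually_ne[OF d_lim]) (simp add: d_def)
  then have "\<forall>\<^sub>F p in nhds w. \<forall>j. d p j \<noteq> 0"
    by (simp add: eventually_all_finite)
  moreover note eventually_rank_full[OF A_lim rk]
  ultimately show ?thesis
  proof eventually_elim
    case (elim p)
    have "(\<Sum>i\<in>UNIV. A p $ i $ j) = 0" for j
      by (simp add: A_def sum_subtractf A0 w flip: sum_distrib_left)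
    moreover have "(\<Sum>i\<in>UNIV. A p $ i $ j * p $ i $ j) = 0" for j
    proof -
      have "(\<Sum>i\<in>UNIV. A p $ i $ j * p $ i $ j) = (\<Sum>i\<in>UNIV. A0 $ i $ j * p $ i $ j) - c p j * d p j"
        by (simp add: A_def d_def sum_distrib_left sum_subtractf algebra_simps)
      then show ?thesis using elim by (simp add: c_def)
    qed
    ultimately show ?case
      using elim unfolding nonzero_entries_def by blast
  qed
qed

text \<open>Column \<open>j\<close> of \<open>A0\<close> is 1 except for \<open>-2 * N\<close> in
  row \<open>e j\<close>, so its \<open>2 * N + 1\<close> entries add up to 0. Column
  \<open>j\<close> of \<open>w\<close> is a difference of unit vectors in two other rows, where
  \<open>A0\<close> has equal entries.\<close>

lemma exists_orthogonal_base_point: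
  obtains A0 w :: "(real ^ ('n::finite option)) ^ (('n + 'n) option)"
  where "nonzero_entries A0" and "rank A0 = CARD('n option)"
    and "\<And>j. (\<Sum>i\<in>UNIV. A0 $ i $ j) = 0"
    and "\<And>j. (\<Sum>i\<in>UNIV. w $ i $ j) = 0"
    and "\<And>j. (\<Sum>i\<in>UNIV. A0 $ i $ j * w $ i $ j) = 0"
    and "\<And>j. (\<Sum>i\<in>UNIV. w $ i $ j * w $ i $ j) \<noteq> 0"
proof
  define N where "N = real CARD('n)"
  have N: "N > 0" by (simp add: N_def)
  \<comment> \<open>For each column, three distinct rows. \<open>undefined\<close> only serves as
    some element of \<open>'n\<close>. No \<open>e j\<close> lies in the \<open>Inr\<close> block,
    which matters for the rank.\<close>
  define e r s :: "'n option \<Rightarrow> ('n + 'n) option"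
    where "e = map_option Inl"
      and "r = (\<lambda>j. case j of None \<Rightarrow> Some (Inl undefined) | Some k \<Rightarrow> None)"
      and "s = (\<lambda>j. case j of None \<Rightarrow> Some (Inr undefined) | Some k \<Rightarrow> Some (Inr k))"
  have dist: "e j \<noteq> r j" "e j \<noteq> s j" "r j \<noteq> s j" for j
    by (auto simp: e_def r_def s_def split: option.split)
  have inj_e: "e j = e j' \<longleftrightarrow> j = j'" for j j'
    by (cases j; cases j') (auto simp: e_def)
  have e_Inr: "e j \<noteq> Some (Inr k)" for j k
    by (cases j) (auto simp: e_def)
  let ?A = "(\<chi> i j. 1 - (2 * N + 1) * of_bool (i = e j)) :: (real ^ ('n option)) ^ (('n + 'n) option)"
  let ?w = "(\<chi> i j. of_bool (i = r j) - of_bool (i = s j)) :: (real ^ ('n option)) ^ (('n + 'n) option)"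
  have delta: "(\<Sum>i\<in>UNIV. of_bool (i = k) * f i) = f k" for k :: "('n + 'n) option" and f :: "_ \<Rightarrow> real"
    by simp
  have delta1: "(\<Sum>i\<in>UNIV. of_bool (i = k)) = (1::real)" for k :: "('n + 'n) option"
    using delta[of k "\<lambda>_. 1"] by simp
  show "nonzero_entries ?A"
    using N by (simp add: nonzero_entries_def of_bool_def)
  show "(\<Sum>i\<in>UNIV. ?A $ i $ j) = 0" for j
    by (simp add: sum_subtractf delta1 card_UNIV_option card_UNIV_sum N_def flip: sum_distrib_left)
  show "(\<Sum>i\<in>UNIV. ?w $ i $ j) = 0" for j
    by (simp add: sum_subtractf delta1)
  have w: "(\<Sum>i\<in>UNIV. f i * ?w $ i $ j) = f (r j) - f (s j)" for f j
    using delta[of "r j" f] delta[of "s j" f] by (simp add: algebra_simps sum_subtractf)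
  show "(\<Sum>i\<in>UNIV. ?A $ i $ j * ?w $ i $ j) = 0" for j
    unfolding w using dist[of j] by simp
  show "(\<Sum>i\<in>UNIV. ?w $ i $ j * ?w $ i $ j) \<noteq> 0" for j
    unfolding w using dist[of j] by simp
  have "x = 0" if "?A *v x = 0" for x
  proof -
    have "(\<Sum>j\<in>UNIV. (1 - (2 * N + 1) * of_bool (i = e j)) * x $ j) = 0" for i
      using that by (simp add: matrix_vector_mult_def vec_eq_iff)
    then have eq: "(\<Sum>j\<in>UNIV. x $ j) = (2 * N + 1) * (\<Sum>j\<in>UNIV. of_bool (i = e j) * x $ j)" for i
      by (simp add: left_diff_distrib sum_subtractf mult.assoc flip: sum_distrib_left)
    \<comment> \<open>A row outside the range of \<open>e\<close> consists of ones and gives the sum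
      of the \<open>x $ j\<close>; row \<open>e k\<close> then isolates
      \<open>x $ k\<close>.\<close>
    have "(\<Sum>j\<in>UNIV. x $ j) = 0"
      using eq[of "Some (Inr undefined)"] e_Inr[symmetric] by simp
    moreover have "(\<Sum>j\<in>UNIV. of_bool (e k = e j) * x $ j) = x $ k" for k
      by (simp add: inj_e)
    ultimately have "x $ k = 0" for k
      using eq[of "e k"] N by simp
    then show ?thesis by (simp add: vec_eq_iff)
  qed
  then show "rank ?A = CARD('n option)"
    unfolding full_rank_injective matrix_left_invertible_injective[symmetric]
      matrix_left_invertible_ker by blast
qed

theorem theorem2:
  "\<not> (\<exists>S :: ((real ^ ('n::finite option)) ^ (('n + 'n) option)) set.
        closed S \<and> S \<in> null_sets lebesgue \<and>
        (\<forall>p. p \<notin> S \<longrightarrow>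
           (\<forall>A :: (real ^ ('n option)) ^ (('n + 'n) option).
              nonzero_entries A \<and> rank A = CARD('n) + 1
                \<longrightarrow> A_equivalent (gen_dist_sq p A) whitney_umbrella) \<and>
           (\<forall>A :: (real ^ ('n option)) ^ (('n + 'n) option).
              nonzero_entries A \<and> rank A < CARD('n) + 1
                \<longrightarrow> A_equivalent (gen_dist_sq p A) std_inclusion)))"
proof (rule notI, elim exE conjE)
  fix S :: "((real ^ ('n option)) ^ (('n + 'n) option)) set"
  assume null: "S \<in> null_sets lebesgue"
    and S: "\<forall>p. p \<notin> S \<longrightarrow>
           (\<forall>A :: (real ^ ('n option)) ^ (('n + 'n) option).
              nonzero_entries A \<and> rank A = CARD('n) + 1
                \<longrightarrow> A_equivalent (gen_dist_sq p A) whitney_umbrella) \<and>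
           (\<forall>A :: (real ^ ('n option)) ^ (('n + 'n) option).
              nonzero_entries A \<and> rank A < CARD('n) + 1
                \<longrightarrow> A_equivalent (gen_dist_sq p A) std_inclusion)"
  obtain A0 w :: "(real ^ ('n option)) ^ (('n + 'n) option)"
    where "nonzero_entries A0" "rank A0 = CARD('n option)"
      "\<And>j. (\<Sum>i\<in>UNIV. A0 $ i $ j) = 0" "\<And>j. (\<Sum>i\<in>UNIV. w $ i $ j) = 0"
      "\<And>j. (\<Sum>i\<in>UNIV. A0 $ i $ j * w $ i $ j) = 0"
      "\<And>j. (\<Sum>i\<in>UNIV. w $ i $ j * w $ i $ j) \<noteq> 0"
    using exists_orthogonal_base_point by blast
  from eventually_orthogonal_matrix[OF this] obtain U where "open U" "w \<in> U"
    and U: "\<And>p. p \<in> U \<Longrightarrow> \<exists>A :: (real ^ ('n option)) ^ (('n + 'n) option).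
      nonzero_entries A \<and> rank A = CARD('n option) \<and>
      (\<forall>j. (\<Sum>i\<in>UNIV. A $ i $ j) = 0) \<and> (\<forall>j. (\<Sum>i\<in>UNIV. A $ i $ j * p $ i $ j) = 0)"
    unfolding eventually_nhds by blast
  \<comment> \<open>A non-empty open set is not negligible.\<close>
  have "\<not> U \<subseteq> S"
    using null \<open>open U\<close> \<open>w \<in> U\<close> open_not_negligible negligible_subset negligible_iff_null_sets
    by blast
  then obtain p where p: "p \<in> U" "p \<notin> S" by blast
  from U[OF p(1)] obtain A :: "(real ^ ('n option)) ^ (('n + 'n) option)"
    where A: "nonzero_entries A" "rank A = CARD('n option)"
      and sums: "\<And>j. (\<Sum>i\<in>UNIV. A $ i $ j) = 0" "\<And>j. (\<Sum>i\<in>UNIV. A $ i $ j * p $ i $ j) = 0"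
    by blast
  have "A_equivalent (gen_dist_sq p A) whitney_umbrella"
    using S p(2) A by (simp add: card_UNIV_option)
  \<comment> \<open>The vector \<open>1\<close> has all entries 1, so pairing with it sums the
    components.\<close>
  moreover have "(1 :: real ^ (('n + 'n) option)) \<bullet> gen_dist_sq p A x =
      (\<Sum>j\<in>UNIV. \<Sum>i\<in>UNIV. A $ i $ j * (p $ i $ j)\<^sup>2)" for x
    using sum_gen_dist_sq_const[OF sums] by (simp add: inner_vec_def)
  ultimately have "(1 :: real ^ (('n + 'n) option)) = 0"
    by (rule A_equivalent_whitney_umbrella_not_in_hyperplane)
  then show False by simp
qed

end
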